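(* Let $\hbar>0$. Consider a one-mode centered Gaussian state at its Williamson representative $\Sigma=\nu\mathbb 1_2$ and put $x=2\nu/\hbar$. Let $E_0=\mathbb 1_2/\sqrt2$ be the trace-normalized radial covector and let $E_1,E_2$ be any trace-orthonormal basis of the traceless symmetric $2\times2$ covectors. Then the dual Bures form satisfies $$g_{\rm B}^*(E_0,E_0)=2\hbar^2(x^2-1),\qquad g_{\rm B}^*(E_a,E_a)=2\hbar^2(x^2+1)\quad(a=1,2),$$ and all cross terms $g_{\rm B}^*(E_\alpha,E_\beta)$, $\alpha\ne\beta$, vanish. Consequently, as $x\downarrow1$, the radial eigenvalue vanishes while the two shape eigenvalues approach $4\hbar^2$, so the limiting one-mode covariance cometric loses exactly one rank. Equivalently, the primal metric $g_{\rm B}$ diverges in the spectrum-changing radial direction $E_0$ as $x\downarrow 1$, while the metric in the traceless directions, tangent to the pure Gaussian orbit, remains finite. In particular the Bures covariance geometry has no positive-definite radial continuation through the Williamson floor: the form $g_{\rm B}^*$ at $\nu\mathbb 1_2$ is not positive definite at $x=1$, nor for $0<x<1$.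
   Context: $\Omega=\begin{pmatrix}0&1\\-1&0\end{pmatrix}$. One-mode quantum covariance matrices are $2\times2$ real positive definite matrices with symplectic eigenvalue $\nu\ge\hbar/2$; the value $\nu=\hbar/2$ (i.e. $x=1$) is the Williamson floor (pure states), and $\nu\mathbb 1_2$ is the Williamson normal form. The dual Bures form (cometric) at $\Sigma$ on symmetric covectors is the quadratic form $$g_{\rm B}^*(\Sigma;P,P)=8\operatorname{Tr}(P\Sigma P\Sigma)+2\hbar^2\operatorname{Tr}(P\Omega P\Omega),$$ with associated symmetric bilinear form obtained by polarization; eigenvalues are taken with respect to the trace inner product $\operatorname{Tr}(PQ)$ on $\operatorname{Sym}(2)$, the real symmetric $2\times 2$ matrices. The primal Bures metric for $x>1$ is $g_{\rm B}(X,Y)=\frac18\operatorname{Tr}[\mathcal S_\Sigma^{-1}(X)Y]$ with $\mathcal S_\Sigma(G)=\Sigma G\Sigma+\frac{\hbar^2}{4}\Omega G\Omega$ on $\operatorname{Sym}(2)$; it is the inverse of $g^*_{\rm B}$ under the trace pairing. *)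

theory Defs
  imports "HOL-Analysis.Analysis"
begin

definition Omega :: "real^2^2" where
  "Omega = vector [vector [0, 1], vector [-1, 0]]"

definition Sym2 :: "(real^2^2) set" where
  "Sym2 = {P. transpose P = P}"

definition traceless_Sym2 :: "(real^2^2) set" where
  "traceless_Sym2 = {P \<in> Sym2. trace P = 0}"

definition radial_covector :: "real^2^2" where
  "radial_covector = (1 / sqrt 2) *\<^sub>R mat 1"

definition trace_orthonormal_basis ::
    "'i set \<Rightarrow> ('i \<Rightarrow> real^2^2) \<Rightarrow> (real^2^2) set \<Rightarrow> bool" where
  "trace_orthonormal_basis I E V \<longleftrightarrow>
     (\<forall>i\<in>I. \<forall>j\<in>I. trace (E i ** E j) = (if i = j then 1 else 0)) \<and> span (E ` I) = V"

definition bures_dual_quad :: "real \<Rightarrow> real^2^2 \<Rightarrow> real^2^2 \<Rightarrow> real" where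
  "bures_dual_quad hbar \<Sigma> P =
     8 * trace (P ** \<Sigma> ** P ** \<Sigma>) + 2 * hbar\<^sup>2 * trace (P ** Omega ** P ** Omega)"

definition bures_dual :: "real \<Rightarrow> real^2^2 \<Rightarrow> real^2^2 \<Rightarrow> real^2^2 \<Rightarrow> real" where
  "bures_dual hbar \<Sigma> P Q =
     (bures_dual_quad hbar \<Sigma> (P + Q) - bures_dual_quad hbar \<Sigma> (P - Q)) / 4"

definition bures_op :: "real \<Rightarrow> real^2^2 \<Rightarrow> real^2^2 \<Rightarrow> real^2^2" where
  "bures_op hbar \<Sigma> G = \<Sigma> ** G ** \<Sigma> + (hbar\<^sup>2 / 4) *\<^sub>R (Omega ** G ** Omega)"

text \<open>
  Only meaningful where \<open>bures_op hbar \<Sigma>\<close> is a bijection of \<open>Sym2\<close>; at \<open>\<Sigma> = \<nu> 1\<close> this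
  holds for \<open>\<nu> > hbar / 2\<close>, see \<open>bures_op_bij\<close> below.
\<close>

definition bures_primal :: "real \<Rightarrow> real^2^2 \<Rightarrow> real^2^2 \<Rightarrow> real^2^2 \<Rightarrow> real" where
  "bures_primal hbar \<Sigma> X Y = 1 / 8 * trace (inv_into Sym2 (bures_op hbar \<Sigma>) X ** Y)"

text \<open>The point \<open>\<nu> 1\<close> with \<open>x = 2 \<nu> / hbar\<close>; the floor is \<open>x = 1\<close>.\<close>

definition williamson_point :: "real \<Rightarrow> real \<Rightarrow> real^2^2" where
  "williamson_point hbar x = mat (hbar * x / 2)"

definition form_eigenpair ::
    "(real^2^2) set \<Rightarrow> (real^2^2 \<Rightarrow> real^2^2 \<Rightarrow> real) \<Rightarrow> real \<Rightarrow> real^2^2 \<Rightarrow> bool" where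
  "form_eigenpair V b l P \<longleftrightarrow>
     P \<in> V \<and> P \<noteq> 0 \<and> (\<forall>Q\<in>V. b P Q = l * trace (P ** Q))"

text \<open>
  The rank of a bilinear form is the dimension of the image of \<open>P \<mapsto> b P\<close> in the dual
  space of \<open>V\<close>; the dual is identified with \<open>V\<close> by the trace pairing, which is
  nondegenerate on \<open>Sym2\<close>.
\<close>

definition form_rank :: "(real^2^2) set \<Rightarrow> (real^2^2 \<Rightarrow> real^2^2 \<Rightarrow> real) \<Rightarrow> nat" where
  "form_rank V b = dim {X \<in> V. \<exists>P\<in>V. \<forall>Q\<in>V. trace (X ** Q) = b P Q}"

definition form_pos_def :: "(real^2^2) set \<Rightarrow> (real^2^2 \<Rightarrow> real^2^2 \<Rightarrow> real) \<Rightarrow> bool" where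
  "form_pos_def V b \<longleftrightarrow> (\<forall>P\<in>V. P \<noteq> 0 \<longrightarrow> b P P > 0)"

definition symplectic2 :: "(real^2^2) set" where
  "symplectic2 = {S. S ** Omega ** transpose S = Omega}"

definition pure_gaussian_orbit :: "real \<Rightarrow> (real^2^2) set" where
  "pure_gaussian_orbit hbar = {S ** mat (hbar / 2) ** transpose S | S. S \<in> symplectic2}"

text \<open>Velocities at \<open>p\<close> of curves in \<open>M\<close> through \<open>p\<close>.\<close>

definition tangent_vectors :: "(real^2^2) set \<Rightarrow> real^2^2 \<Rightarrow> (real^2^2) set" where
  "tangent_vectors M p =
     {v. \<exists>\<gamma>::real \<Rightarrow> real^2^2. \<gamma> 0 = p \<and> (\<exists>e>0. \<forall>t. \<bar>t\<bar> < e \<longrightarrow> \<gamma> t \<in> M) \<and>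
         (\<gamma> has_vector_derivative v) (at 0)}"

lemma mat2_eq_iff:
  "(A::real^2^2) = B \<longleftrightarrow>
     A$1$1 = B$1$1 \<and> A$1$2 = B$1$2 \<and> A$2$1 = B$2$1 \<and> A$2$2 = B$2$2"
  by (auto simp: vec_eq_iff forall_2)

lemma mat2_mult_nth: "((A::real^2^2) ** B) $ i $ j = A$i$1 * B$1$j + A$i$2 * B$2$j"
  by (simp add: matrix_matrix_mult_def sum_2)

lemma trace2: "trace (A::real^2^2) = A$1$1 + A$2$2"
  by (simp add: trace_def sum_2)

lemma transpose_nth: "transpose A $ i $ j = A $ j $ i"
  by (simp add: transpose_def)

lemma mat_nth: "mat k $ i $ j = (if i = j then k else 0)"
  by (simp add: mat_def)

lemma Omega_nth [simp]: "Omega$1$1 = 0" "Omega$1$2 = 1" "Omega$2$1 = -1" "Omega$2$2 = 0"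
  by (simp_all add: Omega_def)

lemmas mat2_simps = mat2_eq_iff trace2 mat2_mult_nth mat_nth transpose_nth

lemma Sym2_iff: "P \<in> Sym2 \<longleftrightarrow> P$2$1 = P$1$2"
  by (auto simp: Sym2_def mat2_eq_iff transpose_nth)

lemma bures_op_mat:
  assumes "G \<in> Sym2"
  shows "bures_op hbar (mat \<nu>) G \<in> Sym2"
    and "bures_op hbar (mat \<nu>) G $ 1 $ 1 = \<nu>\<^sup>2 * G$1$1 - hbar\<^sup>2 / 4 * G$2$2"
    and "bures_op hbar (mat \<nu>) G $ 2 $ 2 = \<nu>\<^sup>2 * G$2$2 - hbar\<^sup>2 / 4 * G$1$1"
    and "bures_op hbar (mat \<nu>) G $ 1 $ 2 = (\<nu>\<^sup>2 + hbar\<^sup>2 / 4) * G$1$2"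
  using assms
  by (simp_all add: bures_op_def Sym2_iff mat2_simps power2_eq_square algebra_simps)

lemma Sym2_eqI:
  assumes "A \<in> Sym2" "B \<in> Sym2" "A$1$1 = B$1$1" "A$2$2 = B$2$2" "A$1$2 = B$1$2"
  shows "A = B"
  using assms by (simp add: Sym2_iff mat2_simps)

lemma bures_op_bij:
  assumes "hbar > 0" "\<nu> > hbar / 2"
  shows "bij_betw (bures_op hbar (mat \<nu>)) Sym2 Sym2"
proof -
  define a where "a = \<nu>\<^sup>2"
  define c where "c = hbar\<^sup>2 / 4"
  have c: "c > 0" using assms by (simp add: c_def)
  have "(hbar / 2)\<^sup>2 < \<nu>\<^sup>2" using assms by (intro power_strict_mono) auto
  then have ac: "a > c" by (simp add: a_def c_def power_divide)
  define d where "d = a * a - c * c"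
  have d: "d \<noteq> 0"
    using c ac by (auto simp: d_def square_diff_square_factored)
  have ac0: "a + c \<noteq> 0" using c ac by simp
  note S = bures_op_mat[where hbar = hbar and \<nu> = \<nu>, folded a_def c_def]
  define inv :: "real^2^2 \<Rightarrow> real^2^2" where
    "inv X = vector [vector [(a * X$1$1 + c * X$2$2) / d, X$1$2 / (a + c)],
                     vector [X$1$2 / (a + c), (a * X$2$2 + c * X$1$1) / d]]" for X
  have inv_in: "inv X \<in> Sym2" for X
    by (simp add: inv_def Sym2_iff mat2_simps)
  have inv_nth: "inv X $ 1 $ 1 = (a * X$1$1 + c * X$2$2) / d"
    "inv X $ 2 $ 2 = (a * X$2$2 + c * X$1$1) / d" "inv X $ 1 $ 2 = X$1$2 / (a + c)" for X
    by (simp_all add: inv_def)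
  have e1: "(a * (a * g - c * h) + c * (a * h - c * g)) / d = g" for g h
    using d by (simp add: divide_eq_eq) (simp add: d_def algebra_simps)
  have e2: "a * ((a * g + c * h) / d) - c * ((a * h + c * g) / d) = g" for g h
  proof -
    have "a * ((a * g + c * h) / d) - c * ((a * h + c * g) / d) =
        (a * (a * g + c * h) - c * (a * h + c * g)) / d"
      by (simp add: diff_divide_distrib)
    also have "\<dots> = g" using d by (simp add: divide_eq_eq) (simp add: d_def algebra_simps)
    finally show ?thesis .
  qed
  show ?thesis
  proof (rule bij_betw_byWitness[where f' = inv])
    show "\<forall>G\<in>Sym2. inv (bures_op hbar (mat \<nu>) G) = G"
      using ac0 e1 by (auto intro!: Sym2_eqI inv_in simp: inv_nth S)
    show "\<forall>X\<in>Sym2. bures_op hbar (mat \<nu>) (inv X) = X"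
      using ac0 e2 by (auto intro!: Sym2_eqI S(1) inv_in simp: inv_nth S inv_in)
    show "inv ` Sym2 \<subseteq> Sym2" using inv_in by blast
    show "bures_op hbar (mat \<nu>) ` Sym2 \<subseteq> Sym2" using S(1) by blast
  qed
qed

lemma bures_dual_eq_op: "bures_dual hbar \<Sigma> P Q = 8 * trace (bures_op hbar \<Sigma> P ** Q)"
proof -
  have polar: "trace ((P + Q) ** M ** (P + Q) ** M) - trace ((P - Q) ** M ** (P - Q) ** M) =
      4 * trace (M ** P ** M ** Q)" for M :: "real^2^2"
  proof -
    have eq: "(P + Q) ** M = P ** M + Q ** M" "(P - Q) ** M = P ** M - Q ** M"
      by (simp_all add: mat2_eq_iff mat2_mult_nth algebra_simps)
    have sq: "trace ((A + B) ** (A + B)) - trace ((A - B) ** (A - B)) = 4 * trace (A ** B)"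
      for A B :: "real^2^2"
      by (simp add: trace2 mat2_mult_nth algebra_simps)
    have "trace (P ** M ** Q ** M) = trace (M ** P ** M ** Q)"
      using trace_mul_sym[of "P ** M ** Q" M] by (simp only: matrix_mul_assoc)
    then show ?thesis
      using sq[of "P ** M" "Q ** M"] by (simp only: eq[symmetric] matrix_mul_assoc)
  qed
  have "trace (((hbar\<^sup>2 / 4) *\<^sub>R (Omega ** P ** Omega)) ** Q) =
      hbar\<^sup>2 / 4 * trace (Omega ** P ** Omega ** Q)"
    by (simp add: trace2 mat2_mult_nth algebra_simps)
  moreover have "(A + B) ** Q = A ** Q + B ** Q" for A B :: "real^2^2"
    by (simp add: mat2_eq_iff mat2_mult_nth algebra_simps)
  ultimately have "8 * trace (bures_op hbar \<Sigma> P ** Q) =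
      8 * trace (\<Sigma> ** P ** \<Sigma> ** Q) + 2 * hbar\<^sup>2 * trace (Omega ** P ** Omega ** Q)"
    by (simp add: bures_op_def trace_add)
  moreover have "4 * bures_dual hbar \<Sigma> P Q =
      8 * (4 * trace (\<Sigma> ** P ** \<Sigma> ** Q)) + 2 * hbar\<^sup>2 * (4 * trace (Omega ** P ** Omega ** Q))"
    unfolding polar[symmetric] by (simp add: bures_dual_def bures_dual_quad_def right_diff_distrib)
  ultimately show ?thesis by simp
qed

text \<open>\<open>bures_primal\<close> is the inverse of \<open>bures_dual\<close> under the trace pairing.\<close>

lemma bures_primal_inverse:
  assumes "hbar > 0" "\<nu> > hbar / 2" "X \<in> Sym2" "P \<in> Sym2"
  shows "(\<forall>Y\<in>Sym2. bures_primal hbar (mat \<nu>) X Y = trace (P ** Y)) \<longleftrightarrow>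
         (\<forall>Q\<in>Sym2. bures_dual hbar (mat \<nu>) P Q = trace (X ** Q))"
proof -
  let ?S = "bures_op hbar (mat \<nu>)"
  note bij = bures_op_bij[OF assms(1,2)]
  define Z where "Z = inv_into Sym2 ?S X"
  have Z: "Z \<in> Sym2" "?S Z = X"
    using assms(3) bij unfolding Z_def bij_betw_def
    by (auto intro: inv_into_into f_inv_into_f)
  have nondeg: "A = B"
    if "A \<in> Sym2" "B \<in> Sym2" "\<forall>Y\<in>Sym2. trace (A ** Y) = trace (B ** Y)" for A B :: "real^2^2"
  proof -
    have "A - B \<in> Sym2" using that(1,2) by (simp add: Sym2_iff mat2_simps)
    then have "trace (A ** (A - B)) = trace (B ** (A - B))" using that(3) by blast
    then have "(A$1$1 - B$1$1)\<^sup>2 + 2 * (A$1$2 - B$1$2)\<^sup>2 + (A$2$2 - B$2$2)\<^sup>2 = 0"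
      using that(1,2) by (simp add: Sym2_iff mat2_simps power2_eq_square algebra_simps)
    then have "A$1$1 = B$1$1" "A$1$2 = B$1$2" "A$2$2 = B$2$2"
      by (smt (verit) zero_le_power2 zero_eq_power2)+
    then show ?thesis using that(1,2) by (simp add: Sym2_iff mat2_simps)
  qed
  have lin: "?S (8 *\<^sub>R P) = 8 *\<^sub>R ?S P"
    by (simp add: bures_op_def mat2_simps algebra_simps)
  have P8: "8 *\<^sub>R P \<in> Sym2" "8 *\<^sub>R ?S P \<in> Sym2"
    using assms(4) bij_betwE[OF bij] by (auto simp: Sym2_iff mat2_simps)
  have tr8: "trace ((8 *\<^sub>R A) ** Y) = 8 * trace (A ** Y)" for A Y :: "real^2^2"
    by (simp add: mat2_simps algebra_simps)
  have "(\<forall>Y\<in>Sym2. bures_primal hbar (mat \<nu>) X Y = trace (P ** Y)) \<longleftrightarrow> Z = 8 *\<^sub>R P"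
    using nondeg[OF Z(1) P8(1)] by (auto simp: bures_primal_def Z_def[symmetric] tr8)
  also have "\<dots> \<longleftrightarrow> X = 8 *\<^sub>R ?S P"
    using Z P8 lin bij by (metis bij_betw_def inj_onD)
  also have "\<dots> \<longleftrightarrow> (\<forall>Q\<in>Sym2. bures_dual hbar (mat \<nu>) P Q = trace (X ** Q))"
    using nondeg[OF assms(3) P8(2)] by (auto simp: bures_dual_eq_op tr8)
  finally show ?thesis .
qed

end

(* On Sym(2) one has Omega G Omega = G - Tr(G) 1, so at nu 1 the operator S_Sigma is
   G |-> (nu^2 + hbar^2/4) G - (hbar^2/4) Tr(G) 1.  Hence the cometric is
   2 hbar^2 ((x^2 + 1) Tr(PQ) - Tr(P) Tr(Q)), from which eigenvalues, rank and inverse are read off.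
   The pure orbit lies in the symmetric matrices of determinant hbar^2/4; differentiating the
   determinant at (hbar/2) 1 shows that velocities are traceless, and the Cholesky factorization
   produces curves in the orbit with any prescribed traceless velocity. *)
theory Submission
  imports Defs
begin

section \<open>Symmetric matrices under the trace pairing\<close>

lemma subspace_Sym2: "subspace Sym2"
  by (auto simp: subspace_def Sym2_iff)

lemma radial_in_Sym2: "radial_covector \<in> Sym2"
  by (simp add: radial_covector_def Sym2_iff mat_nth)

lemma trace_radial: "trace radial_covector = sqrt 2"
  by (simp add: radial_covector_def trace2 mat_nth real_div_sqrt)

lemma trace_radial_mult: "trace (radial_covector ** Q) = trace Q / sqrt 2"
  by (simp add: radial_covector_def mat2_simps add_divide_distrib)

lemma trace_mult_radial: "trace (Q ** radial_covector) = trace Q / sqrt 2"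
  by (metis trace_radial_mult trace_mul_sym)

lemma trace_radial_radial: "trace (radial_covector ** radial_covector) = 1"
  by (simp add: trace_radial_mult trace_radial)

lemma trace_scaleR: "trace (k *\<^sub>R A) = k * trace A" for A :: "real^'n^'n"
  by (simp add: trace_def sum_distrib_left)

lemma scaleR_matrix_assoc: "k *\<^sub>R (A ** B) = (k *\<^sub>R A) ** B"
  for A :: "real^'n^'m" and B :: "real^'p^'n"
  by (simp add: vec_eq_iff matrix_matrix_mult_def sum_distrib_left mult.assoc)

lemma matrix_add_rdistrib: "(A + B) ** C = A ** C + B ** C"
  for A B :: "real^'n^'m" and C :: "real^'p^'n"
  by (simp add: vec_eq_iff matrix_matrix_mult_def sum.distrib distrib_right)

lemma matrix_diff_rdistrib: "(A - B) ** C = A ** C - B ** C"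
  for A B :: "real^'n^'m" and C :: "real^'p^'n"
  by (simp add: vec_eq_iff matrix_matrix_mult_def sum_subtractf left_diff_distrib)

text \<open>The inner product of the library is Tr(A^T B); symmetry of \<open>A\<close> removes the
  transpose. This gives access to definiteness and to facts on orthogonal sets.\<close>

lemma inner_Sym2: "A \<in> Sym2 \<Longrightarrow> A \<bullet> B = trace (A ** B)" for A B :: "real^2^2"
  by (simp add: inner_vec_def sum_2 mat2_simps Sym2_iff)

text \<open>Nondegeneracy of the trace pairing: testing against \<open>A - B\<close> itself yields
  the squared norm of the difference.\<close>

lemma trace_Sym2_eqI:
  assumes "A \<in> Sym2" "B \<in> Sym2" "\<And>Y. Y \<in> Sym2 \<Longrightarrow> trace (A ** Y) = trace (B ** Y)"
  shows "A = B"
proof -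
  have "A - B \<in> Sym2"
    using assms(1,2) by (simp add: Sym2_iff)
  then have "A \<bullet> (A - B) = B \<bullet> (A - B)"
    using assms by (simp add: inner_Sym2)
  then have "(A - B) \<bullet> (A - B) = 0"
    by (simp add: inner_diff_left)
  then show ?thesis by simp
qed

section \<open>Closed forms of the cometric and the metric at multiples of the identity\<close>

lemma bures_op_eq_trace:
  assumes "G \<in> Sym2"
  shows "bures_op hbar (mat \<nu>) G = (\<nu>\<^sup>2 + hbar\<^sup>2 / 4) *\<^sub>R G - (hbar\<^sup>2 / 4 * trace G) *\<^sub>R mat 1"
  using assms
  by (simp add: bures_op_def Sym2_iff mat2_simps power2_eq_square algebra_simps)

lemma bures_dual_williamson:
  assumes "P \<in> Sym2"
  shows "bures_dual hbar (williamson_point hbar x) P Q =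
    2 * hbar\<^sup>2 * ((x\<^sup>2 + 1) * trace (P ** Q) - trace P * trace Q)"
proof -
  have "trace (bures_op hbar (mat (hbar * x / 2)) P ** Q) =
      ((hbar * x / 2)\<^sup>2 + hbar\<^sup>2 / 4) * trace (P ** Q) - hbar\<^sup>2 / 4 * trace P * trace Q"
    unfolding bures_op_eq_trace[OF assms]
    by (simp add: trace_scaleR trace_sub matrix_diff_rdistrib flip: scaleR_matrix_assoc)
  then show ?thesis
    by (simp add: bures_dual_eq_op williamson_point_def power_divide power_mult_distrib algebra_simps)
qed

text \<open>The pole at x = 1 sits in the product of the traces alone. It causes the radial
  divergence and disappears for traceless \<open>X\<close>.\<close>

lemma bures_primal_williamson:
  assumes "hbar > 0" "x > 1" "X \<in> Sym2"
  shows "bures_primal hbar (williamson_point hbar x) X Y =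
    (trace (X ** Y) + trace X * trace Y / (x\<^sup>2 - 1)) / (2 * hbar\<^sup>2 * (x\<^sup>2 + 1))"
proof -
  \<comment> \<open>\<open>W\<close> solves S(W) = X with S the operator \<open>bures_op\<close>.
    Taking traces gives Tr X = (hbar^2/4)(x^2 - 1) Tr W, and once Tr W is known the equation is
    linear in \<open>W\<close> with scalar coefficient (hbar^2/4)(x^2 + 1).\<close>
  define W where "W = (4 / (hbar\<^sup>2 * (x\<^sup>2 + 1))) *\<^sub>R (X + (trace X / (x\<^sup>2 - 1)) *\<^sub>R mat 1)"
  have x: "x\<^sup>2 > 1" using assms(2) by (simp add: one_less_power)
  have nz: "x\<^sup>2 - 1 \<noteq> 0" "x\<^sup>2 + 1 \<noteq> 0" "hbar\<^sup>2 \<noteq> 0" using x assms(1) by auto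
  have W: "W \<in> Sym2"
    using assms(3) by (simp add: W_def Sym2_iff mat_nth)
  have trW: "trace W = 4 * trace X / (hbar\<^sup>2 * (x\<^sup>2 - 1))"
  proof -
    have "trace W = 4 / (hbar\<^sup>2 * (x\<^sup>2 + 1)) * (trace X + trace X / (x\<^sup>2 - 1) * 2)"
      by (simp add: W_def trace_scaleR trace_add trace2[of "mat 1"] mat_nth)
    also have "\<dots> = 4 * trace X / (hbar\<^sup>2 * (x\<^sup>2 - 1))"
      using nz by (simp add: divide_simps) (simp add: algebra_simps)
    finally show ?thesis .
  qed
  have "bures_op hbar (mat (hbar * x / 2)) W = X"
  proof -
    have e1: "((hbar * x / 2)\<^sup>2 + hbar\<^sup>2 / 4) *\<^sub>R W = X + (trace X / (x\<^sup>2 - 1)) *\<^sub>R mat 1"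
    proof -
      have "((hbar * x / 2)\<^sup>2 + hbar\<^sup>2 / 4) * (4 / (hbar\<^sup>2 * (x\<^sup>2 + 1))) =
          (hbar\<^sup>2 * (x\<^sup>2 + 1)) / (hbar\<^sup>2 * (x\<^sup>2 + 1))"
        by (simp add: power_divide power_mult_distrib distrib_left add_divide_distrib)
      also have "\<dots> = 1"
        using nz by simp
      finally show ?thesis
        by (simp only: W_def scaleR_scaleR scaleR_one)
    qed
    have e2: "hbar\<^sup>2 / 4 * trace W = trace X / (x\<^sup>2 - 1)"
      using nz by (simp add: trW field_simps)
    show ?thesis
      unfolding bures_op_eq_trace[OF W] e1 e2 by simp
  qed
  moreover have "inj_on (bures_op hbar (mat (hbar * x / 2))) Sym2"
    using bures_op_bij[of hbar "hbar * x / 2"] assms by (simp add: bij_betw_def)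
  ultimately have "inv_into Sym2 (bures_op hbar (williamson_point hbar x)) X = W"
    using W by (metis inv_into_f_f williamson_point_def)
  then have "bures_primal hbar (williamson_point hbar x) X Y = 1 / 8 * trace (W ** Y)"
    by (simp add: bures_primal_def)
  also have "trace (W ** Y) =
      4 / (hbar\<^sup>2 * (x\<^sup>2 + 1)) * (trace (X ** Y) + trace X * trace Y / (x\<^sup>2 - 1))"
    by (simp add: W_def trace_scaleR trace_add matrix_add_rdistrib flip: scaleR_matrix_assoc)
  also have "1 / 8 * (4 / h * t) = t / (2 * h)" for h t :: real
    by simp
  finally show ?thesis
    by (simp only: mult.assoc)
qed

section \<open>Trace-orthonormal bases and dimensions\<close>

text \<open>Nonzero pairwise orthogonal vectors are independent. The ranks 3 and 2 are obtained by
  counting the given basis in this way.\<close>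

lemma dim_trace_orthonormal_basis:
  assumes "trace_orthonormal_basis I E V" "V \<subseteq> Sym2" "finite I"
  shows "dim V = card I"
proof -
  have orth: "trace (E i ** E j) = (if i = j then 1 else 0)" if "i \<in> I" "j \<in> I" for i j
    using assms(1) that by (simp add: trace_orthonormal_basis_def)
  have span: "span (E ` I) = V"
    using assms(1) by (simp add: trace_orthonormal_basis_def)
  have S: "E i \<in> Sym2" if "i \<in> I" for i
    using that span span_base assms(2) by blast
  have inj: "inj_on E I"
    using orth by (metis inj_onI zero_neq_one)
  have nz: "0 \<notin> E ` I"
    using orth S by (metis imageE inner_Sym2 inner_zero_left zero_neq_one)
  have "pairwise orthogonal (E ` I)"
    using orth S by (auto simp: pairwise_def orthogonal_def inner_Sym2)
  then have "independent (E ` I)"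
    using nz by (rule pairwise_orthogonal_independent)
  then have "dim (span (E ` I)) = card (E ` I)"
    by (simp add: dim_eq_card_independent)
  then show ?thesis
    using span inj by (simp add: card_image)
qed

text \<open>The identity is trace-orthogonal to the traceless matrices, and every symmetric matrix
  splits into a radial and a traceless part.\<close>

lemma trace_orthonormal_basis_insert_radial:
  assumes E: "trace_orthonormal_basis I E traceless_Sym2" and "i \<notin> I" "E i = radial_covector"
  shows "trace_orthonormal_basis (insert i I) E Sym2"
  unfolding trace_orthonormal_basis_def
proof (intro conjI ballI)
  have span: "span (E ` I) = traceless_Sym2"
    using E by (simp add: trace_orthonormal_basis_def)
  have tr: "E j \<in> Sym2" "trace (E j) = 0" if "j \<in> I" for j
    using that span span_base[of "E j" "E ` I"] by (auto simp: traceless_Sym2_def)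
  show "trace (E j ** E k) = (if j = k then 1 else 0)" if "j \<in> insert i I" "k \<in> insert i I" for j k
    using that assms E tr
    by (auto simp: trace_orthonormal_basis_def trace_radial trace_radial_mult trace_mult_radial)
  show "span (E ` insert i I) = Sym2"
  proof
    have "E ` insert i I \<subseteq> Sym2"
      using tr assms(3) radial_in_Sym2 by auto
    then show "span (E ` insert i I) \<subseteq> Sym2"
      by (simp add: span_minimal subspace_Sym2)
    show "Sym2 \<subseteq> span (E ` insert i I)"
    proof
      fix X assume X: "X \<in> Sym2"
      \<comment> \<open>The radial coordinate of \<open>X\<close>, namely its trace pairing with
        \<open>radial_covector\<close>.\<close>
      define k where "k = trace X / sqrt 2"
      have "trace (k *\<^sub>R radial_covector) = trace X"
        by (simp add: k_def trace2 radial_covector_def mat_nth)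
      then have "trace (X - k *\<^sub>R radial_covector) = 0"
        by (simp add: trace_sub)
      moreover have "X - k *\<^sub>R radial_covector \<in> Sym2"
        using X radial_in_Sym2 by (simp add: subspace_Sym2 subspace_diff subspace_scale)
      ultimately have "X - k *\<^sub>R radial_covector \<in> span (E ` I)"
        by (simp add: span traceless_Sym2_def)
      then show "X \<in> span (E ` insert i I)"
        using assms(3) by (auto simp: span_insert)
    qed
  qed
qed

section \<open>Rank of the cometric above and at the floor\<close>

text \<open>By nondegeneracy, the only symmetric matrix representing the functional of
  \<open>P\<close> is 8 S(P), with S the operator \<open>bures_op\<close>. The rank of the form is
  therefore that of S on \<open>Sym2\<close>.\<close>

lemma form_rank_bures_dual:
  "form_rank Sym2 (bures_dual hbar (mat \<nu>)) = dim ((\<lambda>P. 8 *\<^sub>R bures_op hbar (mat \<nu>) P) ` Sym2)"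
proof -
  have "X \<in> Sym2 \<and> (\<exists>P\<in>Sym2. \<forall>Q\<in>Sym2. trace (X ** Q) = bures_dual hbar (mat \<nu>) P Q) \<longleftrightarrow>
      X \<in> (\<lambda>P. 8 *\<^sub>R bures_op hbar (mat \<nu>) P) ` Sym2" for X
  proof -
    have tr: "bures_dual hbar (mat \<nu>) P Q = trace ((8 *\<^sub>R bures_op hbar (mat \<nu>) P) ** Q)" for P Q
      by (simp add: bures_dual_eq_op trace2 mat2_mult_nth algebra_simps)
    have S: "8 *\<^sub>R bures_op hbar (mat \<nu>) P \<in> Sym2" if "P \<in> Sym2" for P
      using that by (simp add: bures_op_mat subspace_Sym2 subspace_scale)
    show ?thesis
      unfolding tr image_iff using S trace_Sym2_eqI by metis
  qed
  then have "{X \<in> Sym2. \<exists>P\<in>Sym2. \<forall>Q\<in>Sym2. trace (X ** Q) = bures_dual hbar (mat \<nu>) P Q} =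
      (\<lambda>P. 8 *\<^sub>R bures_op hbar (mat \<nu>) P) ` Sym2"
    by blast
  then show ?thesis
    by (simp add: form_rank_def)
qed

lemma dim_scale_image:
  fixes S :: "'a::euclidean_space set"
  assumes "k \<noteq> 0"
  shows "dim ((*\<^sub>R) k ` S) = dim S"
  using assms by (intro dim_image_eq) (auto simp: linear_scaleR inj_on_def)

lemma form_rank_bures_dual_above_floor:
  assumes "hbar > 0" "x > 1"
  shows "form_rank Sym2 (bures_dual hbar (williamson_point hbar x)) = dim Sym2"
proof -
  have "bures_op hbar (mat (hbar * x / 2)) ` Sym2 = Sym2"
    using bures_op_bij[of hbar "hbar * x / 2"] assms by (simp add: bij_betw_def)
  then have "(\<lambda>P. 8 *\<^sub>R bures_op hbar (mat (hbar * x / 2)) P) ` Sym2 = (*\<^sub>R) 8 ` Sym2"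
    by (metis image_image)
  then show ?thesis
    by (simp add: williamson_point_def form_rank_bures_dual dim_scale_image)
qed

text \<open>At the floor the two coefficients of the operator balance: up to the factor hbar^2/2 it
  becomes the projection of \<open>Sym2\<close> onto the traceless part, with the radial line as
  kernel.\<close>

lemma form_rank_bures_dual_floor:
  assumes "hbar > 0"
  shows "form_rank Sym2 (bures_dual hbar (williamson_point hbar 1)) = dim traceless_Sym2"
proof -
  have op: "8 *\<^sub>R bures_op hbar (mat (hbar / 2)) P =
      (4 * hbar\<^sup>2) *\<^sub>R (P - (trace P / 2) *\<^sub>R mat 1)" if "P \<in> Sym2" for P
    by (simp add: bures_op_eq_trace[OF that] power_divide scaleR_diff_right)
  have "(\<lambda>P. P - (trace P / 2) *\<^sub>R mat 1) ` Sym2 = traceless_Sym2"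
  proof (intro equalityI subsetI)
    fix X assume "X \<in> traceless_Sym2"
    then show "X \<in> (\<lambda>P. P - (trace P / 2) *\<^sub>R mat 1) ` Sym2"
      by (intro image_eqI[where x = X]) (auto simp: traceless_Sym2_def)
  qed (auto simp: traceless_Sym2_def Sym2_iff trace2 mat_nth)
  then have "(\<lambda>P. 8 *\<^sub>R bures_op hbar (mat (hbar / 2)) P) ` Sym2 =
      (*\<^sub>R) (4 * hbar\<^sup>2) ` traceless_Sym2"
    using op by (metis (mono_tags, lifting) image_cong image_image)
  then show ?thesis
    using assms by (simp add: williamson_point_def form_rank_bures_dual dim_scale_image)
qed

section \<open>The pure Gaussian orbit and its tangent space\<close>

text \<open>Symplectic 2 x 2 matrices have determinant one, so congruence preserves the determinant
  of (hbar/2) 1. These two equations constrain the velocities of curves in the orbit.\<close>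

lemma pure_gaussian_orbit_Sym2_det:
  assumes "G \<in> pure_gaussian_orbit hbar"
  shows "G $ 2 $ 1 = G $ 1 $ 2" "G $ 1 $ 1 * G $ 2 $ 2 - G $ 1 $ 2 * G $ 1 $ 2 = (hbar / 2)\<^sup>2"
proof -
  obtain S where G: "G = S ** mat (hbar / 2) ** transpose S" and S: "S ** Omega ** transpose S = Omega"
    using assms unfolding pure_gaussian_orbit_def symplectic2_def by blast
  have det: "S$1$1 * S$2$2 - S$1$2 * S$2$1 = 1"
  proof -
    \<comment> \<open>The upper right entry of S Omega S^T is the determinant of
      \<open>S\<close>.\<close>
    have "(S ** Omega ** transpose S) $ 1 $ 2 = 1"
      by (simp only: S Omega_nth)
    then show ?thesis
      by (simp add: mat2_mult_nth transpose_nth mult.commute)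
  qed
  show "G $ 2 $ 1 = G $ 1 $ 2"
    by (simp add: G mat2_mult_nth transpose_nth mat_nth ac_simps)
  have "G $ 1 $ 1 * G $ 2 $ 2 - G $ 1 $ 2 * G $ 1 $ 2 =
      (hbar / 2)\<^sup>2 * (S$1$1 * S$2$2 - S$1$2 * S$2$1)\<^sup>2"
    by (simp add: G mat2_mult_nth transpose_nth mat_nth power2_eq_square algebra_simps)
  then show "G $ 1 $ 1 * G $ 2 $ 2 - G $ 1 $ 2 * G $ 1 $ 2 = (hbar / 2)\<^sup>2"
    by (simp add: det)
qed

text \<open>The last entry is forced by the determinant. With r the square root of \<open>p\<close>,
  the lower triangular Cholesky factor has diagonal r, 1/r, hence determinant one, and is
  symplectic.\<close>

lemma cholesky_in_pure_gaussian_orbit: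
  assumes "p > 0"
  shows "vector [vector [hbar / 2 * p, hbar / 2 * q],
                 vector [hbar / 2 * q, hbar / 2 * ((1 + q\<^sup>2) / p)]] \<in> pure_gaussian_orbit hbar"
proof -
  obtain r where r: "r > 0" "p = r * r"
    using assms real_sqrt_mult_self[of p] by (metis abs_of_pos real_sqrt_gt_zero)
  define S :: "real^2^2" where "S = vector [vector [r, 0], vector [q / r, 1 / r]]"
  have "S \<in> symplectic2"
    using r by (simp add: S_def symplectic2_def mat2_simps)
  moreover have "vector [vector [hbar / 2 * p, hbar / 2 * q],
                 vector [hbar / 2 * q, hbar / 2 * ((1 + q\<^sup>2) / p)]] = S ** mat (hbar / 2) ** transpose S"
    using r by (simp add: S_def mat2_simps field_simps power2_eq_square)
  ultimately show ?thesis
    by (auto simp: pure_gaussian_orbit_def)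
qed

text \<open>Reduces velocities to entries, where the rules for real derivatives apply.\<close>

lemma has_vector_derivative_matrix_iff:
  fixes \<gamma> :: "real \<Rightarrow> real^'m^'n"
  shows "(\<gamma> has_vector_derivative v) (at t) \<longleftrightarrow>
    (\<forall>i j. ((\<lambda>t. \<gamma> t $ i $ j) has_real_derivative v $ i $ j) (at t))"
  by (auto simp: has_vector_derivative_def has_real_derivative_iff_has_vector_derivative
      has_derivative_componentwise_within[of \<gamma>] Basis_vec_def inner_axis)

lemma tangent_vectors_pure_gaussian_orbit:
  assumes "hbar > 0"
  shows "tangent_vectors (pure_gaussian_orbit hbar) (mat (hbar / 2)) = traceless_Sym2"
proof (intro equalityI subsetI)
  fix v assume "v \<in> tangent_vectors (pure_gaussian_orbit hbar) (mat (hbar / 2))"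
  then obtain \<gamma> e where g0: "\<gamma> 0 = mat (hbar / 2)" and e: "e > 0"
    and g: "\<And>t. \<bar>t\<bar> < e \<Longrightarrow> \<gamma> t \<in> pure_gaussian_orbit hbar"
    and d: "(\<gamma> has_vector_derivative v) (at 0)"
    by (auto simp: tangent_vectors_def)
  have D: "((\<lambda>t. \<gamma> t $ i $ j) has_real_derivative v $ i $ j) (at 0)" for i j
    using d by (simp add: has_vector_derivative_matrix_iff)
  have near: "eventually (\<lambda>t. \<gamma> t \<in> pure_gaussian_orbit hbar) (nhds 0)"
    using e g by (auto simp: eventually_nhds_metric)
  \<comment> \<open>The off-diagonal entries of the curve agree near 0, so the derivative of one is
    also that of the other.\<close>
  have "((\<lambda>t. \<gamma> t $ 1 $ 2) has_real_derivative v $ 2 $ 1) (at 0)"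
    by (rule has_field_derivative_cong_eventually[THEN iffD1, OF _ _ D])
       (use near g[of 0] e in \<open>auto intro: eventually_at_filter[THEN iffD2] elim!: eventually_mono simp: pure_gaussian_orbit_Sym2_det\<close>)
  then have sym: "v $ 2 $ 1 = v $ 1 $ 2"
    using D DERIV_unique by blast
  \<comment> \<open>The determinant is differentiated twice: the product rule at (hbar/2) 1 gives
    hbar/2 times the trace of \<open>v\<close>, while constancy near 0 gives zero.\<close>
  have "((\<lambda>t. \<gamma> t $ 1 $ 1 * \<gamma> t $ 2 $ 2 - \<gamma> t $ 1 $ 2 * \<gamma> t $ 1 $ 2) has_real_derivative
      hbar / 2 * (v $ 1 $ 1 + v $ 2 $ 2)) (at 0)"
    by (rule derivative_eq_intros D refl)+ (simp add: g0 mat_nth algebra_simps)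
  moreover have "((\<lambda>t. \<gamma> t $ 1 $ 1 * \<gamma> t $ 2 $ 2 - \<gamma> t $ 1 $ 2 * \<gamma> t $ 1 $ 2)
      has_real_derivative 0) (at 0)"
    by (rule DERIV_cong_ev[THEN iffD2, OF refl _ refl DERIV_const[of "(hbar / 2)\<^sup>2"]])
       (use near in \<open>auto elim!: eventually_mono simp: pure_gaussian_orbit_Sym2_det\<close>)
  ultimately have "hbar / 2 * (v $ 1 $ 1 + v $ 2 $ 2) = 0"
    using DERIV_unique by blast
  with sym assms show "v \<in> traceless_Sym2"
    by (simp add: traceless_Sym2_def Sym2_iff trace2)
next
  fix v assume "v \<in> traceless_Sym2"
  then have v: "v $ 2 $ 1 = v $ 1 $ 2" "v $ 2 $ 2 = - v $ 1 $ 1"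
    by (auto simp: traceless_Sym2_def Sym2_iff trace2)
  \<comment> \<open>The slopes are chosen so that hbar/2 times \<open>p\<close> and \<open>q\<close>
    has derivatives \<open>v $ 1 $ 1\<close> and \<open>v $ 1 $ 2\<close>. Since q(0) = 0 and p(0) =
    1, the last entry then has derivative \<open>- v $ 1 $ 1\<close>, as tracelessness
    demands.\<close>
  define p where "p t = 1 + 2 * v $ 1 $ 1 / hbar * t" for t
  define q where "q t = 2 * v $ 1 $ 2 / hbar * t" for t
  define \<gamma> :: "real \<Rightarrow> real^2^2" where
    "\<gamma> t = vector [vector [hbar / 2 * p t, hbar / 2 * q t],
                   vector [hbar / 2 * q t, hbar / 2 * ((1 + (q t)\<^sup>2) / p t)]]" for t
  have "(p \<longlongrightarrow> 1) (at 0)"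
    unfolding p_def using assms by (auto intro!: tendsto_eq_intros)
  \<comment> \<open>Cholesky factorization needs p > 0, which holds near 0 only. The filter
    \<open>at 0\<close> omits t = 0, so that point is covered separately by p(0) = 1.\<close>
  then have "eventually (\<lambda>t. p t > 0) (at 0)"
    by (rule order_tendstoD) simp
  then obtain e where e: "e > 0" "\<And>t. t \<noteq> 0 \<Longrightarrow> \<bar>t\<bar> < e \<Longrightarrow> p t > 0"
    by (auto simp: eventually_at)
  have p0: "p 0 = 1" "q 0 = 0" by (simp_all add: p_def q_def)
  have "\<gamma> t \<in> pure_gaussian_orbit hbar" if "\<bar>t\<bar> < e" for t
    unfolding \<gamma>_def using e(2)[of t] that p0
    by (intro cholesky_in_pure_gaussian_orbit) (cases "t = 0"; simp)
  moreover have "\<gamma> 0 = mat (hbar / 2)"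
    by (simp add: \<gamma>_def p0 mat2_simps)
  moreover have "(\<gamma> has_vector_derivative v) (at 0)"
  proof -
    have Dp: "(p has_real_derivative 2 * v $ 1 $ 1 / hbar) (at 0)"
      unfolding p_def using assms by (auto intro!: derivative_eq_intros)
    have Dq: "(q has_real_derivative 2 * v $ 1 $ 2 / hbar) (at 0)"
      unfolding q_def using assms by (auto intro!: derivative_eq_intros)
    have "((\<lambda>t. hbar / 2 * p t) has_real_derivative v $ 1 $ 1) (at 0)"
      "((\<lambda>t. hbar / 2 * q t) has_real_derivative v $ 1 $ 2) (at 0)"
      "((\<lambda>t. hbar / 2 * ((1 + (q t)\<^sup>2) / p t)) has_real_derivative - v $ 1 $ 1) (at 0)"
      using assms p0 by (auto intro!: derivative_eq_intros Dp Dq)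
    then show ?thesis
      by (simp add: has_vector_derivative_matrix_iff forall_2 \<gamma>_def v)
  qed
  ultimately show "v \<in> tangent_vectors (pure_gaussian_orbit hbar) (mat (hbar / 2))"
    using e(1) by (auto simp: tangent_vectors_def)
qed

section \<open>Spectrum, rank and boundary behaviour at the floor\<close>

theorem theorem6:
  fixes hbar :: real and E :: "nat \<Rightarrow> real^2^2"
  assumes "hbar > 0"
    and "E 0 = radial_covector"
    and "trace_orthonormal_basis {1, 2} E traceless_Sym2"
  shows "(\<forall>\<nu>>0. let \<Sigma> = mat \<nu>; x = 2 * \<nu> / hbar in
            bures_dual hbar \<Sigma> (E 0) (E 0) = 2 * hbar\<^sup>2 * (x\<^sup>2 - 1) \<and>
            (\<forall>a\<in>{1, 2}. bures_dual hbar \<Sigma> (E a) (E a) = 2 * hbar\<^sup>2 * (x\<^sup>2 + 1)) \<and>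
            (\<forall>\<alpha>\<in>{0, 1, 2}. \<forall>\<beta>\<in>{0, 1, 2}. \<alpha> \<noteq> \<beta> \<longrightarrow>
               bures_dual hbar \<Sigma> (E \<alpha>) (E \<beta>) = 0))
       \<and> (\<exists>lam :: nat \<Rightarrow> real \<Rightarrow> real.
            (\<forall>x\<ge>1. \<forall>\<alpha>\<in>{0, 1, 2}.
               form_eigenpair Sym2 (bures_dual hbar (williamson_point hbar x))
                 (lam \<alpha> x) (E \<alpha>)) \<and>
            (lam 0 \<longlongrightarrow> 0) (at_right 1) \<and>
            (\<forall>a\<in>{1, 2}. (lam a \<longlongrightarrow> 4 * hbar\<^sup>2) (at_right 1)))
       \<and> (\<forall>P\<in>Sym2. \<forall>Q\<in>Sym2.
            ((\<lambda>x. bures_dual hbar (williamson_point hbar x) P Q) \<longlongrightarrow>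
               bures_dual hbar (williamson_point hbar 1) P Q) (at_right 1))
       \<and> (\<forall>x>1. form_rank Sym2 (bures_dual hbar (williamson_point hbar x)) = 3)
       \<and> form_rank Sym2 (bures_dual hbar (williamson_point hbar 1)) = 2
       \<and> filterlim (\<lambda>x. bures_primal hbar (williamson_point hbar x) (E 0) (E 0))
            at_top (at_right 1)
       \<and> (\<forall>X\<in>traceless_Sym2. \<forall>Y\<in>traceless_Sym2. \<exists>L.
            ((\<lambda>x. bures_primal hbar (williamson_point hbar x) X Y) \<longlongrightarrow> L) (at_right 1))
       \<and> tangent_vectors (pure_gaussian_orbit hbar) (williamson_point hbar 1) = traceless_Sym2
       \<and> (\<forall>x. 0 < x \<and> x \<le> 1 \<longrightarrow>
            \<not> form_pos_def Sym2 (bures_dual hbar (williamson_point hbar x)))"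
proof -
  define lam :: "nat \<Rightarrow> real \<Rightarrow> real" where
    "lam \<alpha> x = 2 * hbar\<^sup>2 * (if \<alpha> = 0 then x\<^sup>2 - 1 else x\<^sup>2 + 1)" for \<alpha> x
  note E0 = assms(2) and basis = assms(3)
  have basis3: "trace_orthonormal_basis {0, 1, 2} E Sym2"
    using trace_orthonormal_basis_insert_radial[OF basis, of 0] E0 by simp
  have orth: "trace (E \<alpha> ** E \<beta>) = (if \<alpha> = \<beta> then 1 else 0)"
    if "\<alpha> \<in> {0, 1, 2}" "\<beta> \<in> {0, 1, 2}" for \<alpha> \<beta>
    using basis3 that unfolding trace_orthonormal_basis_def by blast
  have traceless: "E a \<in> Sym2" "trace (E a) = 0" if "a \<in> {1, 2}" for a
    using that basis span_base[of "E a" "E ` {1, 2}"]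
    by (auto simp: trace_orthonormal_basis_def traceless_Sym2_def)
  have Sym: "E \<alpha> \<in> Sym2" if "\<alpha> \<in> {0, 1, 2}" for \<alpha>
    using that traceless(1) E0 radial_in_Sym2 by auto
  \<comment> \<open>Leaving \<open>Q\<close> arbitrary lets one identity serve the diagonal values,
    the cross terms and the eigenvector equations.\<close>
  have dual_E: "bures_dual hbar (williamson_point hbar x) (E \<alpha>) Q = lam \<alpha> x * trace (E \<alpha> ** Q)"
    if "\<alpha> \<in> {0, 1, 2}" for x \<alpha> Q
  proof (cases "\<alpha> = 0")
    case True
    \<comment> \<open>In the radial case Tr(E_0) Tr(Q) = 2 Tr(E_0 Q), which lowers x^2 + 1 to x^2 -
      1.\<close>
    have "sqrt 2 * y = 2 * (y / sqrt 2)" for y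
      by (simp add: real_div_sqrt field_simps)
    then show ?thesis
      by (simp add: True E0 bures_dual_williamson radial_in_Sym2 trace_radial trace_radial_mult
          lam_def algebra_simps add_divide_distrib)
  next
    case False
    with that have "\<alpha> \<in> {1, 2}" by auto
    with False traceless[OF this] show ?thesis
      by (simp add: bures_dual_williamson lam_def)
  qed
  have mat_eq: "mat \<nu> = williamson_point hbar (2 * \<nu> / hbar)" for \<nu>
    using assms(1) by (simp add: williamson_point_def)

  have entries: "\<forall>\<nu>>0. let \<Sigma> = mat \<nu>; x = 2 * \<nu> / hbar in
      bures_dual hbar \<Sigma> (E 0) (E 0) = 2 * hbar\<^sup>2 * (x\<^sup>2 - 1) \<and>
      (\<forall>a\<in>{1, 2}. bures_dual hbar \<Sigma> (E a) (E a) = 2 * hbar\<^sup>2 * (x\<^sup>2 + 1)) \<and>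
      (\<forall>\<alpha>\<in>{0, 1, 2}. \<forall>\<beta>\<in>{0, 1, 2}. \<alpha> \<noteq> \<beta> \<longrightarrow> bures_dual hbar \<Sigma> (E \<alpha>) (E \<beta>) = 0)"
    unfolding Let_def mat_eq by (auto simp: dual_E orth lam_def)

  have "form_eigenpair Sym2 (bures_dual hbar (williamson_point hbar x)) (lam \<alpha> x) (E \<alpha>)"
    if "\<alpha> \<in> {0, 1, 2}" for x \<alpha>
  proof -
    have "E \<alpha> \<noteq> 0"
      using orth[OF that that] inner_Sym2[OF Sym[OF that], of "E \<alpha>"] by auto
    then show ?thesis
      using that Sym dual_E by (simp add: form_eigenpair_def)
  qed
  moreover have "(lam 0 \<longlongrightarrow> 0) (at_right 1)"
    unfolding lam_def by (auto intro!: tendsto_eq_intros)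
  moreover have "(lam a \<longlongrightarrow> 4 * hbar\<^sup>2) (at_right 1)" if "a \<in> {1, 2}" for a
    using that unfolding lam_def by (auto intro!: tendsto_eq_intros)
  ultimately have eigen: "\<exists>lam :: nat \<Rightarrow> real \<Rightarrow> real.
      (\<forall>x\<ge>1. \<forall>\<alpha>\<in>{0, 1, 2}.
         form_eigenpair Sym2 (bures_dual hbar (williamson_point hbar x)) (lam \<alpha> x) (E \<alpha>)) \<and>
      (lam 0 \<longlongrightarrow> 0) (at_right 1) \<and> (\<forall>a\<in>{1, 2}. (lam a \<longlongrightarrow> 4 * hbar\<^sup>2) (at_right 1))"
    by blast

  have limit: "\<forall>P\<in>Sym2. \<forall>Q\<in>Sym2. ((\<lambda>x. bures_dual hbar (williamson_point hbar x) P Q) \<longlongrightarrow>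
      bures_dual hbar (williamson_point hbar 1) P Q) (at_right 1)"
    by (auto simp: bures_dual_williamson intro!: tendsto_eq_intros)

  have rank3: "\<forall>x>1. form_rank Sym2 (bures_dual hbar (williamson_point hbar x)) = 3"
    using dim_trace_orthonormal_basis[OF basis3] assms(1)
    by (simp add: form_rank_bures_dual_above_floor)
  have rank2: "form_rank Sym2 (bures_dual hbar (williamson_point hbar 1)) = 2"
    using dim_trace_orthonormal_basis[OF basis] assms(1)
    by (simp add: form_rank_bures_dual_floor traceless_Sym2_def)

  \<comment> \<open>The radial value of the metric is the reciprocal of the radial eigenvalue: the
    numerator 1 + 2/(x^2 - 1) cancels the factor x^2 + 1. Divergence follows, as that eigenvalue
    tends to 0 through positive values.\<close>
  have "bures_primal hbar (williamson_point hbar x) (E 0) (E 0) = inverse (2 * hbar\<^sup>2 * (x\<^sup>2 - 1))"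
    if "x > 1" for x
  proof -
    have cancel: "z / y / (k * z) = inverse (k * y)" if "z \<noteq> 0" for k y z :: real
      using that by (simp add: divide_simps)
    have nz: "x\<^sup>2 - 1 \<noteq> 0" "x\<^sup>2 + 1 \<noteq> 0"
      using one_less_power[OF that, of 2] by auto
    have "bures_primal hbar (williamson_point hbar x) (E 0) (E 0) =
        (1 + 2 / (x\<^sup>2 - 1)) / (2 * hbar\<^sup>2 * (x\<^sup>2 + 1))"
      using assms(1) that
      by (simp add: E0 bures_primal_williamson radial_in_Sym2 trace_radial_radial trace_radial)
    also have "1 + 2 / (x\<^sup>2 - 1) = (x\<^sup>2 + 1) / (x\<^sup>2 - 1)"
      using nz by (simp add: field_simps)
    also have "(x\<^sup>2 + 1) / (x\<^sup>2 - 1) / (2 * hbar\<^sup>2 * (x\<^sup>2 + 1)) = inverse (2 * hbar\<^sup>2 * (x\<^sup>2 - 1))"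
      using cancel[OF nz(2)] .
    finally show ?thesis .
  qed
  then have "eventually (\<lambda>x. inverse (2 * hbar\<^sup>2 * (x\<^sup>2 - 1)) =
      bures_primal hbar (williamson_point hbar x) (E 0) (E 0)) (at_right 1)"
    by (auto simp: eventually_at_filter)
  moreover have "filterlim (\<lambda>x::real. inverse (2 * hbar\<^sup>2 * (x\<^sup>2 - 1))) at_top (at_right 1)"
  proof (rule filterlim_inverse_at_top)
    show "((\<lambda>x. 2 * hbar\<^sup>2 * (x\<^sup>2 - 1)) \<longlongrightarrow> 0) (at_right 1)"
      by (auto intro!: tendsto_eq_intros)
    show "eventually (\<lambda>x. 0 < 2 * hbar\<^sup>2 * (x\<^sup>2 - 1)) (at_right 1)"
      using assms(1) by (auto simp: eventually_at_filter intro!: always_eventually)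
  qed
  ultimately have diverges:
    "filterlim (\<lambda>x. bures_primal hbar (williamson_point hbar x) (E 0) (E 0)) at_top (at_right 1)"
    by (rule filterlim_mono_eventually[OF _ order_refl order_refl, rotated])

  have finite_limit: "\<forall>X\<in>traceless_Sym2. \<forall>Y\<in>traceless_Sym2. \<exists>L.
      ((\<lambda>x. bures_primal hbar (williamson_point hbar x) X Y) \<longlongrightarrow> L) (at_right 1)"
  proof (intro ballI exI)
    fix X Y assume X: "X \<in> traceless_Sym2" and "Y \<in> traceless_Sym2"
    \<comment> \<open>The singular term carries the factor Tr X = 0, and what remains is continuous
      at x = 1.\<close>
    have "eventually (\<lambda>x. trace (X ** Y) / (2 * hbar\<^sup>2 * (x\<^sup>2 + 1)) =
        bures_primal hbar (williamson_point hbar x) X Y) (at_right 1)"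
      using X assms(1)
      by (auto simp: traceless_Sym2_def bures_primal_williamson eventually_at_filter
          intro!: always_eventually)
    moreover have "((\<lambda>x. trace (X ** Y) / (2 * hbar\<^sup>2 * (x\<^sup>2 + 1))) \<longlongrightarrow>
        trace (X ** Y) / (2 * hbar\<^sup>2 * (1\<^sup>2 + 1))) (at_right 1)"
      using assms(1) by (intro tendsto_intros) auto
    ultimately show "((\<lambda>x. bures_primal hbar (williamson_point hbar x) X Y) \<longlongrightarrow>
        trace (X ** Y) / (2 * hbar\<^sup>2 * (1\<^sup>2 + 1))) (at_right 1)"
      by (rule Lim_transform_eventually[rotated])
  qed

  have tangent: "tangent_vectors (pure_gaussian_orbit hbar) (williamson_point hbar 1) = traceless_Sym2"
    using tangent_vectors_pure_gaussian_orbit[OF assms(1)] by (simp add: williamson_point_def)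

  have "\<not> form_pos_def Sym2 (bures_dual hbar (williamson_point hbar x))" if "0 < x" "x \<le> 1" for x
  proof
    assume pd: "form_pos_def Sym2 (bures_dual hbar (williamson_point hbar x))"
    \<comment> \<open>The radial covector is the witness against definiteness: its value is zero at
      x = 1 and negative for 0 < x < 1.\<close>
    have "E 0 \<noteq> 0"
      using orth[of 0 0] inner_Sym2[OF Sym[of 0], of "E 0"] by auto
    then have "0 < bures_dual hbar (williamson_point hbar x) (E 0) (E 0)"
      using pd Sym[of 0] by (simp add: form_pos_def_def)
    also have "\<dots> = 2 * hbar\<^sup>2 * (x\<^sup>2 - 1)"
      by (simp add: dual_E orth lam_def)
    also have "\<dots> \<le> 0"
      using that power_le_one[of x 2] by (intro mult_nonneg_nonpos) auto
    finally show False by simp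
  qed
  then show ?thesis
    using entries eigen limit rank3 rank2 diverges finite_limit tangent by blast
qed

end
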